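(* Let $\mathcal{H}$ be a complex, infinite-dimensional, separable Hilbert space. Suppose that $\mathcal{S} \subseteq \mathcal{B}(\mathcal{H})$ is an irreducible unital semigroup of partial isometries and that there exists a minimal non-zero projection $R \in \mathcal{P}(\mathcal{S}) \cup \mathcal{Q}(\mathcal{S})$. Then the semigroup $\mathcal{V}$ generated by $\mathcal{S}$ and $\mathcal{S}^*$ consists of partial isometries.
   Context: $\mathcal{B}(\mathcal{H})$ is the algebra of bounded linear operators on $\mathcal{H}$. A semigroup in $\mathcal{B}(\mathcal{H})$ is a non-empty subset closed under operator multiplication; it is unital if it contains the identity operator $I$. A partial isometry is an operator $V$ such that $VV^*$ (equivalently $V^*V$) is an orthogonal projection; $Q_V := VV^*$ is its range projection and $P_V := V^*V$ its initial projection. $\mathcal{P}(\mathcal{S}) = \{P_S : S\in\mathcal{S}\}$, $\mathcal{Q}(\mathcal{S}) = \{Q_S : S \in \mathcal{S}\}$, and $\mathcal{S}^*=\{S^*:S\in\mathcal{S}\}$. $\mathcal{S}$ is irreducible if the only closed subspaces of $\mathcal{H}$ invariant under every element of $\mathcal{S}$ are $\{0\}$ and $\mathcal{H}$. If $\mathcal{E}$ is a collection of projections on $\mathcal{H}$, a non-zero projection $E \in \mathcal{E}$ is minimal (in $\mathcal{E}$) if $F \in \mathcal{E}$ and $0 \le F \le E$ imply $F = 0$ or $F = E$; here minimality is in $\mathcal{E}=\mathcal{P}(\mathcal{S}) \cup \mathcal{Q}(\mathcal{S})$. *)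

theory Defs
  imports "HOL-Analysis.Analysis"
begin

text \<open>
  The inner product is linear in its first argument. Completeness comes from the superclass
  \<^class>\<open>banach\<close>; positivity and definiteness of the inner product follow from the axiom that
  ties it to the norm.
\<close>

class complex_hilbert_space = banach +
  fixes scaleC :: "complex \<Rightarrow> 'a \<Rightarrow> 'a"  (infixr \<open>*\<^sub>C\<close> 75)
    and cinner :: "'a \<Rightarrow> 'a \<Rightarrow> complex"
  assumes scaleC_add_right: "c *\<^sub>C (x + y) = c *\<^sub>C x + c *\<^sub>C y"
    and scaleC_add_left: "(c + d) *\<^sub>C x = c *\<^sub>C x + d *\<^sub>C x"
    and scaleC_scaleC: "c *\<^sub>C d *\<^sub>C x = (c * d) *\<^sub>C x"
    and scaleC_one: "1 *\<^sub>C x = x"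
    and scaleR_scaleC: "r *\<^sub>R x = complex_of_real r *\<^sub>C x"
    and cinner_add_left: "cinner (x + y) z = cinner x z + cinner y z"
    and cinner_scaleC_left: "cinner (c *\<^sub>C x) y = c * cinner x y"
    and cinner_commute: "cinner x y = cnj (cinner y x)"
    and cinner_self: "cinner x x = complex_of_real ((norm x)\<^sup>2)"

global_interpretation complex_vector:
  vector_space "scaleC :: complex \<Rightarrow> 'a \<Rightarrow> 'a::complex_hilbert_space"
  defines csubspace = complex_vector.subspace
    and cspan = complex_vector.span
  by unfold_locales (simp_all add: scaleC_add_right scaleC_add_left scaleC_scaleC scaleC_one)

definition bounded_operator :: "('a::complex_hilbert_space \<Rightarrow> 'a) \<Rightarrow> bool" where
  "bounded_operator T \<longleftrightarrow> bounded_linear T \<and> (\<forall>c x. T (c *\<^sub>C x) = c *\<^sub>C T x)"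

text \<open>
  The choice is only meaningful for bounded operators, for which such a map exists (Riesz
  representation) and is unique.
\<close>

definition hilbert_adjoint :: "('a::complex_hilbert_space \<Rightarrow> 'a) \<Rightarrow> 'a \<Rightarrow> 'a" where
  "hilbert_adjoint T = (SOME T'. \<forall>x y. cinner (T x) y = cinner x (T' y))"

definition orthogonal_projection :: "('a::complex_hilbert_space \<Rightarrow> 'a) \<Rightarrow> bool" where
  "orthogonal_projection P \<longleftrightarrow>
     bounded_operator P \<and> P \<circ> P = P \<and> hilbert_adjoint P = P"

definition range_projection :: "('a::complex_hilbert_space \<Rightarrow> 'a) \<Rightarrow> 'a \<Rightarrow> 'a" where
  "range_projection V = V \<circ> hilbert_adjoint V"

definition initial_projection :: "('a::complex_hilbert_space \<Rightarrow> 'a) \<Rightarrow> 'a \<Rightarrow> 'a" where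
  "initial_projection V = hilbert_adjoint V \<circ> V"

definition partial_isometry :: "('a::complex_hilbert_space \<Rightarrow> 'a) \<Rightarrow> bool" where
  "partial_isometry V \<longleftrightarrow>
     bounded_operator V \<and> orthogonal_projection (range_projection V)"

definition operator_le ::
  "('a::complex_hilbert_space \<Rightarrow> 'a) \<Rightarrow> ('a \<Rightarrow> 'a) \<Rightarrow> bool" where
  "operator_le A B \<longleftrightarrow> (\<forall>x. cinner (B x - A x) x \<in> \<real>\<^sub>\<ge>\<^sub>0)"

definition minimal_projection_in ::
  "('a::complex_hilbert_space \<Rightarrow> 'a) set \<Rightarrow> ('a \<Rightarrow> 'a) \<Rightarrow> bool" where
  "minimal_projection_in \<E> E \<longleftrightarrow>
     E \<in> \<E> \<and> orthogonal_projection E \<and> E \<noteq> (\<lambda>x. 0) \<and>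
     (\<forall>F\<in>\<E>. operator_le (\<lambda>x. 0) F \<and> operator_le F E \<longrightarrow> F = (\<lambda>x. 0) \<or> F = E)"

definition operator_semigroup :: "('a::complex_hilbert_space \<Rightarrow> 'a) set \<Rightarrow> bool" where
  "operator_semigroup \<S> \<longleftrightarrow>
     \<S> \<noteq> {} \<and> (\<forall>A\<in>\<S>. bounded_operator A) \<and> (\<forall>A\<in>\<S>. \<forall>B\<in>\<S>. A \<circ> B \<in> \<S>)"

definition unital_semigroup :: "('a::complex_hilbert_space \<Rightarrow> 'a) set \<Rightarrow> bool" where
  "unital_semigroup \<S> \<longleftrightarrow> operator_semigroup \<S> \<and> id \<in> \<S>"

definition irreducible_operators :: "('a::complex_hilbert_space \<Rightarrow> 'a) set \<Rightarrow> bool" where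
  "irreducible_operators \<S> \<longleftrightarrow>
     (\<forall>M. csubspace M \<and> closed M \<and> (\<forall>A\<in>\<S>. A ` M \<subseteq> M) \<longrightarrow> M = {0} \<or> M = UNIV)"

inductive_set generated_semigroup ::
  "('a::complex_hilbert_space \<Rightarrow> 'a) set \<Rightarrow> ('a \<Rightarrow> 'a) set" for \<A> where
  base: "A \<in> \<A> \<Longrightarrow> A \<in> generated_semigroup \<A>"
| comp: "A \<in> generated_semigroup \<A> \<Longrightarrow> B \<in> generated_semigroup \<A> \<Longrightarrow>
    A \<circ> B \<in> generated_semigroup \<A>"

end

theory Submission imports Defs begin

text \<open>
  Minimality and irreducibility produce a member \<open>A\<close> of the semigroup whose initial and range
  projections both equal \<open>R\<close>. Call the nonzero ranges of the operators \<open>TA\<close>, with \<open>T\<close> in the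
  semigroup, blocks; by minimality of \<open>R\<close> every member of the semigroup kills a block or maps it
  isometrically onto a block. If \<open>AUTA \<noteq> 0\<close>, then \<open>TA\<close> and \<open>(AU)\<^sup>*\<close> have the same range, so the blocks
  are also the nonzero ranges of the operators \<open>(AU)\<^sup>*\<close>, and adjoints of members act on blocks in the
  same way. Hence so does every \<open>W\<close> in the generated semigroup, and then \<open>WW\<^sup>*\<close> is zero or the
  identity on each block. As the blocks span a dense subspace, \<open>WW\<^sup>*\<close> is idempotent.
\<close>

section \<open>Inner product\<close>

lemma cinner_add_right: "cinner x (y + z) = cinner x y + cinner x z"
  by (metis cinner_add_left cinner_commute complex_cnj_add)

lemma cinner_scaleC_right: "cinner x (c *\<^sub>C y) = cnj c * cinner x y"
  by (metis cinner_commute cinner_scaleC_left complex_cnj_mult)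

lemma cinner_scaleR_left: "cinner (r *\<^sub>R x) y = of_real r * cinner x y"
  by (simp add: scaleR_scaleC cinner_scaleC_left)

lemma cinner_scaleR_right: "cinner x (r *\<^sub>R y) = of_real r * cinner x y"
  by (simp add: scaleR_scaleC cinner_scaleC_right)

lemma cinner_minus_left: "cinner (- x) y = - cinner x y"
  using cinner_scaleR_left[of "-1" x y] by simp

lemma cinner_minus_right: "cinner x (- y) = - cinner x y"
  using cinner_scaleR_right[of x "-1" y] by simp

lemma cinner_diff_left: "cinner (x - y) z = cinner x z - cinner y z"
  using cinner_add_left[of x "- y" z] by (simp add: cinner_minus_left)

lemma cinner_diff_right: "cinner x (y - z) = cinner x y - cinner x z"
  using cinner_add_right[of x y "- z"] by (simp add: cinner_minus_right)

lemma cinner_zero_left [simp]: "cinner 0 x = 0"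
  using cinner_diff_left[of 0 0 x] by simp

lemma cinner_zero_right [simp]: "cinner x 0 = 0"
  using cinner_diff_right[of x 0 0] by simp

lemma cinner_right_eqI:
  assumes "\<And>x. cinner x y = cinner x z"
  shows "y = z"
proof -
  have "cinner (y - z) (y - z) = 0"
    using assms[of "y - z"] by (simp add: cinner_diff_right)
  then show ?thesis by (simp add: cinner_self)
qed

lemma norm_sq_cinner: "(norm x)\<^sup>2 = Re (cinner x x)"
  by (simp add: cinner_self)

lemma Re_cinner_commute: "Re (cinner x y) = Re (cinner y x)"
  by (subst cinner_commute) simp

lemma norm_sq_add: "(norm (x + y))\<^sup>2 = (norm x)\<^sup>2 + (norm y)\<^sup>2 + 2 * Re (cinner x y)"
  unfolding norm_sq_cinner
  by (simp add: cinner_add_left cinner_add_right Re_cinner_commute[of y x])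

lemma norm_sq_diff: "(norm (x - y))\<^sup>2 = (norm x)\<^sup>2 + (norm y)\<^sup>2 - 2 * Re (cinner x y)"
  unfolding norm_sq_cinner
  by (simp add: cinner_diff_left cinner_diff_right Re_cinner_commute[of y x])

text \<open>Cauchy-Schwarz for real parts comes from the triangle inequality of the norm: squaring
  it and cancelling the two squared norms leaves this bound.\<close>

lemma Re_cinner_le: "Re (cinner x y) \<le> norm x * norm y"
proof -
  have "(norm (x + y))\<^sup>2 \<le> (norm x + norm y)\<^sup>2"
    by (simp add: norm_triangle_ineq power_mono)
  then show ?thesis by (simp add: norm_sq_add power2_sum)
qed

section \<open>Adjoints\<close>

text \<open>
  Riesz representation of a real functional. The representing vector minimizes
  \<open>\<parallel>x\<parallel>\<^sup>2 - 2 f x\<close>; the parallelogram law makes minimizing sequences Cauchy.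
\<close>

lemma real_riesz:
  fixes f :: "'a::complex_hilbert_space \<Rightarrow> real"
  assumes f: "bounded_linear f"
  obtains z where "\<And>x. f x = Re (cinner x z)"
proof -
  interpret f: bounded_linear f by (rule f)
  define J where "J = (\<lambda>x. (norm x)\<^sup>2 - 2 * f x)"
  obtain K where K: "\<And>x. \<bar>f x\<bar> \<le> norm x * K"
    using f.bounded by auto
  have lower: "- K\<^sup>2 \<le> J x" for x
  proof -
    have "0 \<le> (norm x - K)\<^sup>2" by simp
    then have "- K\<^sup>2 \<le> (norm x)\<^sup>2 - 2 * (norm x * K)" by (simp add: power2_diff algebra_simps)
    moreover have "f x \<le> norm x * K" using K[of x] by linarith
    ultimately show ?thesis unfolding J_def by linarith
  qed
  then have bdd: "bdd_below (range J)" by (auto simp: bdd_below_def)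
  define m where "m = Inf (range J)"
  have m: "m \<le> J x" for x unfolding m_def using bdd by (simp add: cInf_lower)
  have "\<exists>x. J x < m + inverse (real (Suc n))" for n
  proof -
    have "Inf (range J) < m + inverse (real (Suc n))" unfolding m_def by simp
    then show ?thesis using cInf_lessD[of "range J"] by auto
  qed
  then obtain X where X: "\<And>n. J (X n) < m + inverse (real (Suc n))" by metis
  have para: "(dist x y)\<^sup>2 \<le> 2 * (J x - m) + 2 * (J y - m)" for x y
  proof -
    have half: "(norm ((1/2) *\<^sub>R (x + y)))\<^sup>2 = (norm (x + y))\<^sup>2 / 4"
      "f ((1/2) *\<^sub>R (x + y)) = (f x + f y) / 2"
      by (simp_all add: power_divide f.scaleR f.add)
    have "J ((1/2) *\<^sub>R (x + y)) = (norm (x + y))\<^sup>2 / 4 - (f x + f y)"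
      unfolding J_def half by (simp add: field_simps)
    with m[of "(1/2) *\<^sub>R (x + y)"] have "4 * m \<le> (norm (x + y))\<^sup>2 - 4 * (f x + f y)" by simp
    then show ?thesis
      unfolding J_def dist_norm using norm_sq_add[of x y] norm_sq_diff[of x y] by simp
  qed
  have "Cauchy X"
  proof (rule metric_CauchyI)
    fix e :: real assume e: "0 < e"
    \<comment> \<open>By \<open>para\<close>, two points with \<open>J\<close> below
      \<open>m + d\<close> have squared distance below \<open>4 * d\<close>, which this choice makes
      \<open>e\<^sup>2\<close>.\<close>
    define d where "d = e\<^sup>2 / 4"
    have "0 < d" using e by (simp add: d_def)
    then obtain N where N: "inverse (real (Suc N)) < d"
      using reals_Archimedean by auto
    have small: "J (X k) < m + d" if "N \<le> k" for k
    proof -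
      have "inverse (real (Suc k)) \<le> inverse (real (Suc N))" using that by (simp add: field_simps)
      then show ?thesis using X[of k] N by linarith
    qed
    have "dist (X i) (X j) < e" if "N \<le> i" "N \<le> j" for i j
    proof -
      have "(dist (X i) (X j))\<^sup>2 < 4 * d"
        using para[of "X i" "X j"] small[OF that(1)] small[OF that(2)] by argo
      then have "(dist (X i) (X j))\<^sup>2 < e\<^sup>2" by (simp add: d_def)
      then show ?thesis using e by (simp add: power_less_imp_less_base)
    qed
    then show "\<exists>N. \<forall>i\<ge>N. \<forall>j\<ge>N. dist (X i) (X j) < e" by blast
  qed
  then obtain z where z: "X \<longlonglongrightarrow> z" using Cauchy_convergent_iff convergent_def by blast
  have "(\<lambda>n. J (X n)) \<longlonglongrightarrow> J z"
    unfolding J_def by (intro tendsto_intros z f.tendsto)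
  moreover have "(\<lambda>n. m + inverse (real (Suc n))) \<longlonglongrightarrow> m + 0"
    by (intro tendsto_intros LIMSEQ_inverse_real_of_nat)
  ultimately have "J z \<le> m + 0"
    by (rule LIMSEQ_le) (meson X less_imp_le)
  then have z_min: "J z \<le> J x" for x using m[of x] by linarith
  have "f x = Re (cinner x z)" for x
  proof (cases "x = 0")
    case False
    define c where "c = Re (cinner x z) - f x"
    \<comment> \<open>This \<open>t\<close> minimizes the quadratic
      \<open>t\<^sup>2 * (norm x)\<^sup>2 + 2 * t * c\<close>. Its minimal value is negative unless
      \<open>c = 0\<close>, while minimality of \<open>J z\<close> makes it nonnegative.\<close>
    define t where "t = - c / (norm x)\<^sup>2"
    have "J (z + t *\<^sub>R x) = J z + t\<^sup>2 * (norm x)\<^sup>2 + 2 * t * c"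
      unfolding J_def c_def
      by (simp add: norm_sq_add f.add f.scaleR cinner_scaleR_right power_mult_distrib
          Re_cinner_commute[of z x] algebra_simps)
    with z_min[of "z + t *\<^sub>R x"] have "0 \<le> t\<^sup>2 * (norm x)\<^sup>2 + 2 * t * c" by simp
    also have "\<dots> = - (c\<^sup>2 / (norm x)\<^sup>2)"
      using False unfolding t_def by (simp add: field_simps power2_eq_square)
    finally have "c\<^sup>2 \<le> 0" using False by (simp add: divide_le_0_iff)
    then show ?thesis unfolding c_def by simp
  qed (simp add: f.zero)
  then show thesis by (rule that)
qed

notation hilbert_adjoint ("_\<^sup>\<dagger>" [1000] 999)

lemma bounded_operator_linear: "bounded_operator T \<Longrightarrow> bounded_linear T"
  by (simp add: bounded_operator_def)

lemma bounded_operator_scaleC: "bounded_operator T \<Longrightarrow> T (c *\<^sub>C x) = c *\<^sub>C T x"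
  by (simp add: bounded_operator_def)

lemma bounded_operator_diff: "bounded_operator T \<Longrightarrow> T (x - y) = T x - T y"
  by (simp add: bounded_linear.linear bounded_operator_linear linear_diff)

lemma bounded_operator_add: "bounded_operator T \<Longrightarrow> T (x + y) = T x + T y"
  by (simp add: bounded_linear.linear bounded_operator_linear linear_add)

lemma bounded_operator_zero: "bounded_operator T \<Longrightarrow> T 0 = 0"
  by (simp add: bounded_linear.linear bounded_operator_linear linear_0)

lemma bounded_operator_comp:
  assumes "bounded_operator S" "bounded_operator T"
  shows "bounded_operator (S \<circ> T)"
  using assms unfolding bounded_operator_def comp_def
  by (auto intro: bounded_linear_compose)

lemma cinner_adjoint_right:
  assumes T: "bounded_operator T"
  shows "cinner (T x) y = cinner x ((T\<^sup>\<dagger>) y)"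
proof -
  have "\<exists>z. \<forall>x. cinner (T x) y = cinner x z" for y
  proof -
    interpret T: bounded_linear T by (rule bounded_operator_linear[OF T])
    obtain K where K: "\<And>x. norm (T x) \<le> norm x * K" using T.bounded by auto
    have "bounded_linear (\<lambda>x. Re (cinner (T x) y))"
    proof (rule bounded_linear_intro)
      show "norm (Re (cinner (T x) y)) \<le> norm x * (K * norm y)" for x
      proof -
        have "\<bar>Re (cinner (T x) y)\<bar> \<le> norm (T x) * norm y"
          using Re_cinner_le[of "T x" y] Re_cinner_le[of "- T x" y]
          by (simp add: cinner_minus_left)
        also have "\<dots> \<le> norm x * K * norm y" using K by (simp add: mult_right_mono)
        finally show ?thesis by (simp add: mult.assoc)
      qed
    qed (simp_all add: T.add T.scaleR cinner_add_left cinner_scaleR_left)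
    then obtain z where z: "\<And>x. Re (cinner (T x) y) = Re (cinner x z)"
      using real_riesz by blast
    \<comment> \<open>The real parts agree at every vector; at \<open>\<i> *\<^sub>C x\<close> this
      says that the imaginary parts agree at \<open>x\<close>.\<close>
    have "cinner (T x) y = cinner x z" for x
      using z[of x] z[of "\<i> *\<^sub>C x"]
      by (simp add: bounded_operator_scaleC[OF T] cinner_scaleC_left complex_eq_iff)
    then show ?thesis by blast
  qed
  then have "\<exists>T'. \<forall>x y. cinner (T x) y = cinner x (T' y)" by metis
  then have "\<forall>x y. cinner (T x) y = cinner x ((T\<^sup>\<dagger>) y)"
    unfolding hilbert_adjoint_def by (rule someI_ex)
  then show ?thesis by blast
qed

lemma cinner_adjoint_left:
  assumes "bounded_operator T"
  shows "cinner ((T\<^sup>\<dagger>) x) y = cinner x (T y)"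
  using cinner_adjoint_right[OF assms, of y x] by (metis cinner_commute)

lemma adjoint_eqI:
  assumes "bounded_operator T" "\<And>x y. cinner (T x) y = cinner x (S y)"
  shows "T\<^sup>\<dagger> = S"
  by (metis assms cinner_adjoint_right cinner_right_eqI ext)

lemma bounded_operator_adjoint:
  assumes T: "bounded_operator T"
  shows "bounded_operator (T\<^sup>\<dagger>)"
proof -
  interpret T: bounded_linear T by (rule bounded_operator_linear[OF T])
  obtain K where K: "\<And>x. norm (T x) \<le> norm x * K" using T.bounded by auto
  have add: "(T\<^sup>\<dagger>) (x + y) = (T\<^sup>\<dagger>) x + (T\<^sup>\<dagger>) y" for x y
    by (rule cinner_right_eqI) (simp add: cinner_add_right flip: cinner_adjoint_right[OF T])
  have scaleC: "(T\<^sup>\<dagger>) (c *\<^sub>C x) = c *\<^sub>C (T\<^sup>\<dagger>) x" for c x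
    by (rule cinner_right_eqI) (simp add: cinner_scaleC_right flip: cinner_adjoint_right[OF T])
  have "norm ((T\<^sup>\<dagger>) y) \<le> norm y * K" for y
  proof (cases "(T\<^sup>\<dagger>) y = 0")
    case True
    have "0 \<le> norm y * K" using K[of y] norm_ge_zero order_trans by blast
    then show ?thesis using True by simp
  next
    case False
    have "(norm ((T\<^sup>\<dagger>) y))\<^sup>2 = Re (cinner (T ((T\<^sup>\<dagger>) y)) y)"
      by (simp add: norm_sq_cinner cinner_adjoint_right[OF T])
    also have "\<dots> \<le> norm (T ((T\<^sup>\<dagger>) y)) * norm y" by (rule Re_cinner_le)
    also have "\<dots> \<le> norm ((T\<^sup>\<dagger>) y) * K * norm y" using K by (simp add: mult_right_mono)
    finally have "norm ((T\<^sup>\<dagger>) y) * norm ((T\<^sup>\<dagger>) y) \<le> norm ((T\<^sup>\<dagger>) y) * (norm y * K)"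
      by (simp add: power2_eq_square algebra_simps)
    then show ?thesis using False by simp
  qed
  then have "bounded_linear (T\<^sup>\<dagger>)"
    by (intro bounded_linear_intro[where K = K]) (simp_all add: add scaleC scaleR_scaleC)
  then show ?thesis by (simp add: bounded_operator_def scaleC)
qed

lemma adjoint_adjoint:
  assumes "bounded_operator T"
  shows "(T\<^sup>\<dagger>)\<^sup>\<dagger> = T"
  by (rule adjoint_eqI) (simp_all add: assms bounded_operator_adjoint cinner_adjoint_left)

lemma adjoint_comp:
  assumes "bounded_operator S" "bounded_operator T"
  shows "(S \<circ> T)\<^sup>\<dagger> = T\<^sup>\<dagger> \<circ> S\<^sup>\<dagger>"
  by (rule adjoint_eqI) (simp_all add: assms bounded_operator_comp cinner_adjoint_right)

lemma norm_sq_adjoint: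
  assumes "bounded_operator T"
  shows "(norm (T x))\<^sup>2 = Re (cinner x ((T\<^sup>\<dagger>) (T x)))"
  by (simp add: norm_sq_cinner cinner_adjoint_right[OF assms])

lemma adjoint_eq_zero:
  assumes "bounded_operator T" "T\<^sup>\<dagger> = (\<lambda>x. 0)"
  shows "T = (\<lambda>x. 0)"
  using norm_sq_adjoint[OF assms(1)] assms(2) by auto

section \<open>Partial isometries\<close>

lemma partial_isometry_bounded: "partial_isometry V \<Longrightarrow> bounded_operator V"
  by (simp add: partial_isometry_def)

text \<open>An algebraic form of the definition, better suited to products and adjoints. Passing
  from idempotence of \<open>range_projection V\<close> to the cubic identity rests on the
  orthogonality of the kernel of \<open>V\<close> and the range of
  \<open>V\<^sup>\<dagger>\<close>.\<close>

lemma partial_isometry_iff: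
  "partial_isometry V \<longleftrightarrow> bounded_operator V \<and> V \<circ> V\<^sup>\<dagger> \<circ> V = V"
proof (cases "bounded_operator V")
  case V: True
  note V' = bounded_operator_adjoint[OF V]
  have bdd: "bounded_operator (range_projection V)"
    unfolding range_projection_def by (rule bounded_operator_comp[OF V V'])
  have adj: "(range_projection V)\<^sup>\<dagger> = range_projection V"
    unfolding range_projection_def by (simp add: adjoint_comp adjoint_adjoint V V')
  have "V (((V\<^sup>\<dagger>)) (V x)) = V x" if idem: "\<And>y. V ((V\<^sup>\<dagger>) (V ((V\<^sup>\<dagger>) y))) = V ((V\<^sup>\<dagger>) y)" for x
  proof -
    have "(V\<^sup>\<dagger>) (V ((V\<^sup>\<dagger>) y)) = (V\<^sup>\<dagger>) y" for y
    proof -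
      \<comment> \<open>This difference lies both in the range of \<open>V\<^sup>\<dagger>\<close>
        and in the kernel of \<open>V\<close>, so it is orthogonal to itself. The resulting identity
        for \<open>V\<^sup>\<dagger>\<close> is then moved to \<open>V\<close> through the inner
        product.\<close>
      let ?d = "(V\<^sup>\<dagger>) (V ((V\<^sup>\<dagger>) y)) - (V\<^sup>\<dagger>) y"
      have "V ?d = 0" by (simp add: bounded_operator_diff V idem)
      have "?d = (V\<^sup>\<dagger>) (V ((V\<^sup>\<dagger>) y) - y)" by (simp add: bounded_operator_diff V')
      then have "cinner ?d ?d = cinner (V ?d) (V ((V\<^sup>\<dagger>) y) - y)"
        by (simp add: cinner_adjoint_right V)
      then have "cinner ?d ?d = 0" by (simp add: \<open>V ?d = 0\<close>)
      then show ?thesis by (simp add: cinner_self)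
    qed
    then have "cinner ((V\<^sup>\<dagger>) (V ((V\<^sup>\<dagger>) y))) x = cinner ((V\<^sup>\<dagger>) y) x" for y
      by (simp only:)
    then have "cinner y (V ((V\<^sup>\<dagger>) (V x))) = cinner y (V x)" for y
      by (simp only: cinner_adjoint_left[OF V] cinner_adjoint_right[OF V])
    then show ?thesis by (rule cinner_right_eqI)
  qed
  then have "range_projection V \<circ> range_projection V = range_projection V \<longleftrightarrow> V \<circ> V\<^sup>\<dagger> \<circ> V = V"
    unfolding range_projection_def comp_def fun_eq_iff by metis
  then show ?thesis
    by (simp add: partial_isometry_def orthogonal_projection_def V bdd adj)
qed (simp add: partial_isometry_def)

lemma partial_isometry_adjoint:
  assumes "partial_isometry V"
  shows "partial_isometry (V\<^sup>\<dagger>)"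
proof -
  have V: "bounded_operator V" and eq: "V \<circ> V\<^sup>\<dagger> \<circ> V = V"
    using assms by (simp_all add: partial_isometry_iff)
  have "(V \<circ> V\<^sup>\<dagger> \<circ> V)\<^sup>\<dagger> = V\<^sup>\<dagger> \<circ> V \<circ> V\<^sup>\<dagger>"
    by (simp add: adjoint_comp adjoint_adjoint V bounded_operator_adjoint bounded_operator_comp
        comp_assoc)
  then show ?thesis
    by (simp add: partial_isometry_iff eq adjoint_adjoint V bounded_operator_adjoint)
qed

text \<open>The cubic identity makes \<open>V\<^sup>\<dagger>\<close> preserve the norm of
  \<open>V x\<close>; Cauchy-Schwarz for \<open>x\<close> and
  \<open>(V\<^sup>\<dagger>) (V x)\<close> then leaves one factor \<open>norm (V x)\<close> to
  cancel.\<close>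

lemma partial_isometry_contraction:
  assumes "partial_isometry V"
  shows "norm (V x) \<le> norm x"
proof -
  have V: "bounded_operator V" and eq: "V ((V\<^sup>\<dagger>) (V y)) = V y" for y
    using assms by (simp_all add: partial_isometry_iff fun_eq_iff)
  have "(norm ((V\<^sup>\<dagger>) (V x)))\<^sup>2 = (norm (V x))\<^sup>2"
    by (simp add: norm_sq_cinner cinner_adjoint_left V eq)
  then have "norm ((V\<^sup>\<dagger>) (V x)) = norm (V x)" by (simp add: power2_eq_iff_nonneg)
  then have "(norm (V x))\<^sup>2 \<le> norm x * norm (V x)"
    using Re_cinner_le[of x "(V\<^sup>\<dagger>) (V x)"] by (simp add: norm_sq_adjoint V)
  then show ?thesis by (cases "V x = 0") (simp_all add: power2_eq_square)
qed

lemma initial_projection_adjoint: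
  "bounded_operator V \<Longrightarrow> initial_projection V = range_projection (V\<^sup>\<dagger>)"
  by (simp add: initial_projection_def range_projection_def adjoint_adjoint)

lemma range_projection_eq_zero:
  assumes "bounded_operator V" "range_projection V = (\<lambda>x. 0)"
  shows "V = (\<lambda>x. 0)"
proof -
  have "V ((V\<^sup>\<dagger>) x) = 0" for x using assms(2) by (simp add: range_projection_def fun_eq_iff)
  then have "V\<^sup>\<dagger> = (\<lambda>x. 0)"
    using norm_sq_adjoint[of "V\<^sup>\<dagger>"] assms(1) by (auto simp: bounded_operator_adjoint adjoint_adjoint)
  then show ?thesis by (rule adjoint_eq_zero[OF assms(1)])
qed

lemma norm_eq_of_initial_projection_eq:
  assumes "bounded_operator V" "bounded_operator W"
    and "initial_projection V = initial_projection W"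
  shows "norm (V x) = norm (W x)"
proof -
  have "(norm (V x))\<^sup>2 = (norm (W x))\<^sup>2"
    using assms(3) by (simp add: norm_sq_adjoint assms(1,2) initial_projection_def fun_eq_iff)
  then show ?thesis by (simp add: power2_eq_iff_nonneg)
qed

text \<open>The equation says that \<open>R\<close> preserves the norm of every
  \<open>(C\<^sup>\<dagger>) x\<close>, and an orthogonal projection preserves only the norms of
  vectors in its range. This turns operator identities into inclusions of ranges.\<close>

lemma range_projection_absorb:
  assumes C: "bounded_operator C" and R: "orthogonal_projection R"
    and eq: "C \<circ> R \<circ> C\<^sup>\<dagger> = C \<circ> C\<^sup>\<dagger>"
  shows "R \<circ> C\<^sup>\<dagger> = C\<^sup>\<dagger>"
proof
  fix x
  have R': "bounded_operator R" "R\<^sup>\<dagger> = R" "\<And>y. R (R y) = R y"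
    using R by (simp_all add: orthogonal_projection_def fun_eq_iff)
  let ?y = "(C\<^sup>\<dagger>) x"
  have "cinner (R ?y) (R ?y) = cinner x (C (R ?y))"
    using R' by (metis C cinner_adjoint_left)
  also have "\<dots> = cinner ?y ?y"
    using eq by (simp add: fun_eq_iff C cinner_adjoint_left)
  finally have "(norm (R ?y))\<^sup>2 = (norm ?y)\<^sup>2" by (simp add: norm_sq_cinner)
  moreover have "Re (cinner (R ?y) ?y) = (norm (R ?y))\<^sup>2"
    using R' by (metis Re_cinner_commute norm_sq_adjoint)
  ultimately have "(norm (R ?y - ?y))\<^sup>2 = 0" by (simp add: norm_sq_diff)
  then show "(R \<circ> C\<^sup>\<dagger>) x = ?y" by simp
qed

section \<open>Minimal projections\<close>

text \<open>Since \<open>C\<^sup>\<dagger>\<close> is a contraction, the range projection of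
  \<open>D \<circ> C\<close> lies below that of \<open>D\<close>, and minimality leaves only zero or
  \<open>R\<close>. The factors need not be in the semigroup: later \<open>D\<close> is also an
  adjoint or \<open>R\<close> itself.\<close>

lemma minimal_projection_absorbs:
  assumes min: "minimal_projection_in \<E> R"
    and D: "bounded_operator D" "range_projection D = R"
    and C: "bounded_operator C" "\<And>x. norm ((C\<^sup>\<dagger>) x) \<le> norm x"
    and mem: "range_projection (D \<circ> C) \<in> \<E>" and nz: "D \<circ> C \<noteq> (\<lambda>x. 0)"
  shows "range_projection (D \<circ> C) = R"
proof -
  note DC = bounded_operator_comp[OF D(1) C(1)]
  \<comment> \<open>The quadratic form of a range projection is a squared norm, so the operator
    inequalities reduce to inequalities between norms.\<close>
  have quad: "cinner (range_projection T x) x = of_real ((norm ((T\<^sup>\<dagger>) x))\<^sup>2)"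
    if "bounded_operator T" for T :: "'a \<Rightarrow> 'a" and x
    by (simp add: range_projection_def cinner_adjoint_right that cinner_self)
  have nonneg: "complex_of_real r \<in> \<real>\<^sub>\<ge>\<^sub>0" if "0 \<le> r" for r using that by simp
  have "operator_le (\<lambda>x. 0) (range_projection (D \<circ> C))"
    unfolding operator_le_def by (simp add: quad[OF DC])
  moreover have "operator_le (range_projection (D \<circ> C)) R"
    unfolding operator_le_def
  proof
    fix x
    have "norm (((D \<circ> C)\<^sup>\<dagger>) x) \<le> norm ((D\<^sup>\<dagger>) x)"
      by (simp add: adjoint_comp C D)
    then have le: "0 \<le> (norm ((D\<^sup>\<dagger>) x))\<^sup>2 - (norm (((D \<circ> C)\<^sup>\<dagger>) x))\<^sup>2"
      by (simp add: power_mono)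
    have "cinner (R x - range_projection (D \<circ> C) x) x
        = of_real ((norm ((D\<^sup>\<dagger>) x))\<^sup>2 - (norm (((D \<circ> C)\<^sup>\<dagger>) x))\<^sup>2)"
      using quad[OF DC, of x] quad[OF D(1), of x] by (simp add: cinner_diff_left D(2))
    then show "cinner (R x - range_projection (D \<circ> C) x) x \<in> \<real>\<^sub>\<ge>\<^sub>0"
      using nonneg[OF le] by (simp only:)
  qed
  ultimately have "range_projection (D \<circ> C) = (\<lambda>x. 0) \<or> range_projection (D \<circ> C) = R"
    using min mem unfolding minimal_projection_in_def by blast
  then show ?thesis using nz range_projection_eq_zero[OF DC] by blast
qed

section \<open>Irreducible semigroups of partial isometries\<close>

locale irreducible_partial_isometries =
  fixes \<S> :: "('a::complex_hilbert_space \<Rightarrow> 'a) set"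
  assumes unital: "unital_semigroup \<S>"
    and pis: "V \<in> \<S> \<Longrightarrow> partial_isometry V"
    and irr: "irreducible_operators \<S>"
begin

abbreviation "\<E> \<equiv> initial_projection ` \<S> \<union> range_projection ` \<S>"

lemma id_mem: "id \<in> \<S>" and comp_mem: "S \<in> \<S> \<Longrightarrow> T \<in> \<S> \<Longrightarrow> S \<circ> T \<in> \<S>"
  using unital by (simp_all add: unital_semigroup_def operator_semigroup_def)

lemma bdd: "S \<in> \<S> \<Longrightarrow> bounded_operator S"
  by (simp add: pis partial_isometry_bounded)

text \<open>The vectors whose whole orbit is killed by \<open>B\<close> form a closed invariant
  subspace. It contains \<open>x \<noteq> 0\<close>, so by irreducibility it is everything, and
  \<open>id \<in> \<S>\<close> gives the claim. This stands in for density of the span of an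
  orbit.\<close>

lemma orbit_annihilator:
  assumes B: "bounded_operator B" and x: "x \<noteq> 0" and z: "\<And>T. T \<in> \<S> \<Longrightarrow> B (T x) = 0"
  shows "B = (\<lambda>x. 0)"
proof -
  define M where "M = {y. \<forall>T\<in>\<S>. B (T y) = 0}"
  have BT: "bounded_operator (\<lambda>y. B (T y))" if "T \<in> \<S>" for T
    using bounded_operator_comp[OF B bdd[OF that]] by (simp add: comp_def)
  have "csubspace M"
    unfolding complex_vector.subspace_def M_def
    by (simp add: bounded_operator_zero[OF bdd] bounded_operator_zero[OF B]
        bounded_operator_add[OF bdd] bounded_operator_add[OF B]
        bounded_operator_scaleC[OF bdd] bounded_operator_scaleC[OF B])
  moreover have "closed M"
  proof -
    have "closed {y. B (T y) = 0}" if "T \<in> \<S>" for T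
      using linear_continuous_on[OF bounded_operator_linear[OF BT[OF that]], of UNIV]
      by (intro closed_Collect_eq) simp_all
    moreover have "M = (\<Inter>T\<in>\<S>. {y. B (T y) = 0})" unfolding M_def by auto
    ultimately show ?thesis by auto
  qed
  moreover have "S ` M \<subseteq> M" if "S \<in> \<S>" for S
  proof
    fix y assume "y \<in> S ` M"
    then obtain u where u: "y = S u" "u \<in> M" by blast
    have "B ((T \<circ> S) u) = 0" if "T \<in> \<S>" for T
      using u(2) comp_mem[OF that \<open>S \<in> \<S>\<close>] unfolding M_def by blast
    then show "y \<in> M" by (simp add: M_def u(1))
  qed
  ultimately have "M = {0} \<or> M = UNIV"
    using irr[unfolded irreducible_operators_def, rule_format, of M] by simp
  moreover have "x \<in> M" using z by (simp add: M_def)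
  ultimately have "M = UNIV" using x by auto
  then have "B (id y) = 0" for y using id_mem unfolding M_def by blast
  then show ?thesis by auto
qed

text \<open>If every such product vanished, \<open>B\<close> would annihilate the orbit of a nonzero
  vector \<open>C x\<close>.\<close>

lemma ex_linking:
  assumes "B \<in> \<S>" "C \<in> \<S>" "B \<noteq> (\<lambda>x. 0)" "C \<noteq> (\<lambda>x. 0)"
  obtains T where "T \<in> \<S>" "B \<circ> T \<circ> C \<noteq> (\<lambda>x. 0)"
proof -
  obtain x where "C x \<noteq> 0" using assms(4) by auto
  then obtain T where "T \<in> \<S>" "B (T (C x)) \<noteq> 0"
    using orbit_annihilator[OF bdd] assms by metis
  then show thesis by (intro that[of T]) (auto simp: fun_eq_iff)
qed

lemma minimal_range:
  assumes "minimal_projection_in \<E> R" "D \<in> \<S>" "C \<in> \<S>" "range_projection D = R"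
    and "D \<circ> C \<noteq> (\<lambda>x. 0)"
  shows "range_projection (D \<circ> C) = R"
proof (rule minimal_projection_absorbs[OF assms(1)])
  show "range_projection (D \<circ> C) \<in> \<E>" using comp_mem assms(2,3) by blast
qed (simp_all add: assms bdd pis partial_isometry_contraction partial_isometry_adjoint)

text \<open>Dual to \<open>minimal_range\<close> by taking adjoints. The operator
  \<open>D\<^sup>\<dagger> \<circ> C\<^sup>\<dagger>\<close> may lie outside \<open>\<S>\<close>,
  but its range projection is the initial projection of \<open>C \<circ> D\<close> and so belongs to
  \<open>\<E>\<close>.\<close>

lemma minimal_initial:
  assumes min: "minimal_projection_in \<E> R" and D: "D \<in> \<S>" and C: "C \<in> \<S>"
    and R: "initial_projection D = R" and nz: "C \<circ> D \<noteq> (\<lambda>x. 0)"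
  shows "initial_projection (C \<circ> D) = R"
proof -
  have eq: "(C \<circ> D)\<^sup>\<dagger> = D\<^sup>\<dagger> \<circ> C\<^sup>\<dagger>" by (simp add: adjoint_comp bdd C D)
  have "range_projection (D\<^sup>\<dagger> \<circ> C\<^sup>\<dagger>) = R"
  proof (rule minimal_projection_absorbs[OF min])
    show "range_projection (D\<^sup>\<dagger>) = R" using R by (simp add: initial_projection_adjoint bdd D)
    show "range_projection (D\<^sup>\<dagger> \<circ> C\<^sup>\<dagger>) \<in> \<E>"
    proof -
      have "initial_projection (C \<circ> D) = range_projection (D\<^sup>\<dagger> \<circ> C\<^sup>\<dagger>)"
        using eq by (simp add: initial_projection_adjoint bdd comp_mem C D)
      then show ?thesis using comp_mem[OF C D] by (metis UnI1 imageI)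
    qed
    show "D\<^sup>\<dagger> \<circ> C\<^sup>\<dagger> \<noteq> (\<lambda>x. 0)"
      using nz adjoint_eq_zero[of "C \<circ> D"] eq comp_mem[OF C D] bdd by auto
    show "norm (((C\<^sup>\<dagger>)\<^sup>\<dagger>) x) \<le> norm x" for x
      by (simp add: adjoint_adjoint bdd C partial_isometry_contraction pis)
  qed (simp_all add: bounded_operator_adjoint bdd C D)
  then show ?thesis using initial_projection_adjoint[of "C \<circ> D"] eq comp_mem[OF C D] bdd by simp
qed

text \<open>Both \<open>B \<circ> R \<circ> B\<^sup>\<dagger>\<close> and
  \<open>B \<circ> B\<^sup>\<dagger>\<close> equal \<open>R\<close>, so
  \<open>range_projection_absorb\<close> puts the range of \<open>B\<^sup>\<dagger>\<close> inside
  that of \<open>R\<close>. The initial projection of \<open>B\<close> is thus a nonzero member of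
  \<open>\<E>\<close> below \<open>R\<close>.\<close>

lemma range_le_imp_initial:
  assumes min: "minimal_projection_in \<E> R" and B: "B \<in> \<S>" and R: "range_projection B = R"
    and eq: "B \<circ> R \<circ> B\<^sup>\<dagger> = R"
  shows "initial_projection B = R"
proof -
  have proj: "bounded_operator R" "R\<^sup>\<dagger> = R" "R \<circ> R = R" "orthogonal_projection R" "R \<noteq> (\<lambda>x. 0)"
    using min by (simp_all add: minimal_projection_in_def orthogonal_projection_def)
  have "R \<circ> B\<^sup>\<dagger> = B\<^sup>\<dagger>"
    using R eq by (intro range_projection_absorb bdd B proj) (simp add: range_projection_def)
  moreover have B': "B\<^sup>\<dagger> \<noteq> (\<lambda>x. 0)"
  proof
    assume "B\<^sup>\<dagger> = (\<lambda>x. 0)"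
    then have "R = (\<lambda>x. 0)"
      using R by (auto simp: range_projection_def bounded_operator_zero[OF bdd[OF B]])
    then show False using proj(5) by contradiction
  qed
  moreover have "range_projection (B\<^sup>\<dagger>) \<in> \<E>"
    using B initial_projection_adjoint[OF bdd[OF B]] by (metis UnI1 imageI)
  ultimately have "range_projection (R \<circ> B\<^sup>\<dagger>) = R"
    using B proj(1-3)
    by (intro minimal_projection_absorbs[OF min])
      (simp_all add: range_projection_def[of R] bounded_operator_adjoint bdd adjoint_adjoint
        partial_isometry_contraction pis)
  then show ?thesis
    by (simp add: \<open>R \<circ> B\<^sup>\<dagger> = B\<^sup>\<dagger>\<close> initial_projection_adjoint bdd B)
qed

text \<open>The argument of \<open>range_le_imp_initial\<close> with the roles of \<open>B\<close>
  and \<open>B\<^sup>\<dagger>\<close> exchanged.\<close>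

lemma initial_le_imp_range:
  assumes min: "minimal_projection_in \<E> R" and B: "B \<in> \<S>" and R: "initial_projection B = R"
    and eq: "B\<^sup>\<dagger> \<circ> R \<circ> B = R"
  shows "range_projection B = R"
proof -
  have proj: "bounded_operator R" "R\<^sup>\<dagger> = R" "R \<circ> R = R" "orthogonal_projection R" "R \<noteq> (\<lambda>x. 0)"
    using min by (simp_all add: minimal_projection_in_def orthogonal_projection_def)
  have "R \<circ> (B\<^sup>\<dagger>)\<^sup>\<dagger> = (B\<^sup>\<dagger>)\<^sup>\<dagger>"
    using R eq by (intro range_projection_absorb bounded_operator_adjoint bdd B proj)
      (simp add: initial_projection_def adjoint_adjoint bdd B)
  then have RB: "R \<circ> B = B" by (simp add: adjoint_adjoint bdd B)
  moreover have "B \<noteq> (\<lambda>x. 0)"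
    using R proj(5) bounded_operator_zero[OF bounded_operator_adjoint[OF bdd[OF B]]]
    by (auto simp: initial_projection_def)
  moreover have "range_projection B \<in> \<E>" using B by blast
  ultimately have "range_projection (R \<circ> B) = R"
    using B proj(1-3)
    by (intro minimal_projection_absorbs[OF min])
      (simp_all add: range_projection_def[of R] bdd
        partial_isometry_contraction partial_isometry_adjoint pis)
  then show ?thesis by (simp add: RB)
qed

text \<open>
  For any \<open>S\<close> with \<open>TST \<noteq> 0\<close>, take \<open>A = TS\<close> if \<open>R\<close> is the range projection of \<open>T\<close>, and \<open>A = ST\<close> if it
  is the initial projection.
\<close>

lemma ex_partial_unitary:
  assumes min: "minimal_projection_in \<E> R"
  obtains A where "A \<in> \<S>" "initial_projection A = R" "range_projection A = R" "A \<noteq> (\<lambda>x. 0)"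
proof -
  have proj: "bounded_operator R" "R\<^sup>\<dagger> = R" "R \<circ> R = R" "orthogonal_projection R" "R \<noteq> (\<lambda>x. 0)"
    and "R \<in> \<E>"
    using min by (simp_all add: minimal_projection_in_def orthogonal_projection_def)
  have nz: "T \<noteq> (\<lambda>x. 0)" if "T \<in> \<S>" "initial_projection T = R \<or> range_projection T = R" for T
    using that proj(5) bounded_operator_zero[OF bounded_operator_adjoint[OF bdd]]
    by (auto simp: initial_projection_def range_projection_def)
  from \<open>R \<in> \<E>\<close> obtain T where T: "T \<in> \<S>" "initial_projection T = R \<or> range_projection T = R"
    by auto
  obtain S where S: "S \<in> \<S>" "T \<circ> S \<circ> T \<noteq> (\<lambda>x. 0)"
    using ex_linking[OF T(1) T(1) nz[OF T] nz[OF T]] .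
  have "initial_projection A = R \<and> range_projection A = R"
    if A: "A = (if range_projection T = R then T \<circ> S else S \<circ> T)" for A
  proof (cases "range_projection T = R")
    case True
    with A have A: "A = T \<circ> S" by simp
    have A_mem: "A \<in> \<S>" using A S T comp_mem by simp
    have "A \<noteq> (\<lambda>x. 0)" using S(2) A by (auto simp: fun_eq_iff)
    then have R: "range_projection A = R"
      using minimal_range[OF min T(1) S(1) True] A by simp
    \<comment> \<open>Here \<open>A \<circ> T\<close> is \<open>T \<circ> S \<circ> T\<close>,
      nonzero by the choice of \<open>S\<close>. Expanding its range projection gives the equation
      that \<open>range_le_imp_initial\<close> asks for.\<close>
    have "range_projection (A \<circ> T) = R"
      using minimal_range[OF min A_mem T(1) R] S(2) A by simp
    then have "A \<circ> range_projection T \<circ> A\<^sup>\<dagger> = R"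
      by (simp add: range_projection_def adjoint_comp bdd A_mem T(1) comp_assoc)
    then show ?thesis using range_le_imp_initial[OF min A_mem R] R True by simp
  next
    case False
    with T(2) have init: "initial_projection T = R" by simp
    from A False have A: "A = S \<circ> T" by simp
    have A_mem: "A \<in> \<S>" using A S T comp_mem by simp
    have "A \<noteq> (\<lambda>x. 0)"
      by (rule notI)
        (use S(2) A bounded_operator_zero[OF bdd[OF T(1)]] in \<open>simp add: fun_eq_iff\<close>)
    then have R: "initial_projection A = R"
      using minimal_initial[OF min T(1) S(1) init] A by simp
    \<comment> \<open>Again the product is \<open>T \<circ> S \<circ> T\<close>, now read from the
      left.\<close>
    have "initial_projection (T \<circ> A) = R"
      using minimal_initial[OF min A_mem T(1) R] S(2) A by (simp add: comp_assoc)
    then have "A\<^sup>\<dagger> \<circ> initial_projection T \<circ> A = R"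
      by (simp add: initial_projection_def adjoint_comp bdd A_mem T(1) comp_assoc)
    then show ?thesis using initial_le_imp_range[OF min A_mem R] R init by simp
  qed
  moreover have "(if range_projection T = R then T \<circ> S else S \<circ> T) \<in> \<S>"
    using S T comp_mem by simp
  ultimately show thesis using nz that by blast
qed

end

section \<open>Blocks and the operators acting on them\<close>

locale partial_unitary_in = irreducible_partial_isometries +
  fixes R A :: "'a \<Rightarrow> 'a"
  assumes min: "minimal_projection_in \<E> R"
    and A_mem: "A \<in> \<S>" and A_nz: "A \<noteq> (\<lambda>x. 0)"
    and A_init: "initial_projection A = R" and A_range: "range_projection A = R"
begin

text \<open>By \<open>minimal_initial\<close> every such \<open>T \<circ> A\<close> has initial
  projection \<open>R\<close>, so each block is an isometric copy of the range of
  \<open>R\<close>.\<close>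

definition blocks :: "'a set set" where
  "blocks = {range (T \<circ> A) | T. T \<in> \<S> \<and> T \<circ> A \<noteq> (\<lambda>x. 0)}"

text \<open>With \<open>X = S \<circ> A\<close> and \<open>Z = A \<circ> T\<close>, minimality makes
  the initial projections of \<open>X\<close> and \<open>Z \<circ> X\<close> and the range
  projections of \<open>Z\<close> and \<open>Z \<circ> X\<close> all equal to \<open>R\<close>. Two
  uses of \<open>range_projection_absorb\<close> then give the two inclusions.\<close>

lemma range_eq_range_adjoint:
  assumes S: "S \<in> \<S>" and T: "T \<in> \<S>" and nz: "(A \<circ> T) \<circ> (S \<circ> A) \<noteq> (\<lambda>x. 0)"
  shows "range (S \<circ> A) = range ((A \<circ> T)\<^sup>\<dagger>)"
proof -
  define X where "X = S \<circ> A"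
  define Z where "Z = A \<circ> T"
  have mem: "X \<in> \<S>" "Z \<in> \<S>" by (simp_all add: X_def Z_def A_mem S T comp_mem)
  have zero: "A 0 = 0" "T 0 = 0"
    by (simp_all add: bounded_operator_zero bdd A_mem T)
  have "X \<noteq> (\<lambda>x. 0)"
    by (rule notI) (use nz zero in \<open>simp add: X_def fun_eq_iff\<close>)
  then have X: "initial_projection X = R"
    unfolding X_def by (rule minimal_initial[OF min A_mem S A_init])
  have "Z \<noteq> (\<lambda>x. 0)" using nz by (auto simp: Z_def fun_eq_iff)
  then have Z: "range_projection Z = R"
    unfolding Z_def by (rule minimal_range[OF min A_mem T A_range])
  \<comment> \<open>The same product \<open>Z \<circ> X\<close> is bracketed once with
    \<open>A\<close> split off on the left and once with \<open>A\<close> split off on the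
    right.\<close>
  have "range_projection (A \<circ> (T \<circ> S \<circ> A)) = R"
    by (rule minimal_range[OF min A_mem _ A_range])
      (use nz in \<open>simp_all add: comp_mem A_mem S T comp_assoc\<close>)
  moreover have "initial_projection ((A \<circ> T \<circ> S) \<circ> A) = R"
    by (rule minimal_initial[OF min A_mem _ A_init])
      (use nz in \<open>simp_all add: comp_mem A_mem S T comp_assoc\<close>)
  ultimately have ZX: "range_projection (Z \<circ> X) = R" "initial_projection (Z \<circ> X) = R"
    by (simp_all add: Z_def X_def comp_assoc)
  note adj = adjoint_comp bdd mem adjoint_adjoint bounded_operator_adjoint
  have "range_projection X \<circ> Z\<^sup>\<dagger> = Z\<^sup>\<dagger>"
  proof (rule range_projection_absorb)
    show "orthogonal_projection (range_projection X)"
      using pis[OF mem(1)] by (simp add: partial_isometry_def)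
    show "Z \<circ> range_projection X \<circ> Z\<^sup>\<dagger> = Z \<circ> Z\<^sup>\<dagger>"
      using ZX(1) Z by (simp add: range_projection_def adj comp_assoc)
  qed (simp add: adj)
  then have sub1: "range (Z\<^sup>\<dagger>) \<subseteq> range X"
    by (auto simp: range_projection_def fun_eq_iff) (metis rangeI)
  have "initial_projection Z \<circ> (X\<^sup>\<dagger>)\<^sup>\<dagger> = (X\<^sup>\<dagger>)\<^sup>\<dagger>"
  proof (rule range_projection_absorb)
    show "orthogonal_projection (initial_projection Z)"
      using partial_isometry_adjoint[OF pis[OF mem(2)]]
      by (simp add: partial_isometry_def initial_projection_adjoint adj)
    show "X\<^sup>\<dagger> \<circ> initial_projection Z \<circ> (X\<^sup>\<dagger>)\<^sup>\<dagger> = X\<^sup>\<dagger> \<circ> (X\<^sup>\<dagger>)\<^sup>\<dagger>"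
      using ZX(2) X by (simp add: initial_projection_def adj comp_assoc)
  qed (simp add: adj)
  then have sub2: "range X \<subseteq> range (Z\<^sup>\<dagger>)"
    by (auto simp: initial_projection_def fun_eq_iff adj) (metis rangeI)
  show ?thesis using sub1 sub2 by (simp add: X_def Z_def)
qed

text \<open>\<open>ex_linking\<close> supplies for each operator on one side a partner on the other
  with nonzero product, as \<open>range_eq_range_adjoint\<close> requires. This description makes
  adjoints of members tractable.\<close>

lemma blocks_adjoint:
  "blocks = {range ((A \<circ> U)\<^sup>\<dagger>) | U. U \<in> \<S> \<and> A \<circ> U \<noteq> (\<lambda>x. 0)}"
proof (intro subset_antisym subsetI)
  fix M assume "M \<in> blocks"
  then obtain S where S: "S \<in> \<S>" "S \<circ> A \<noteq> (\<lambda>x. 0)" "M = range (S \<circ> A)"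
    by (auto simp: blocks_def)
  obtain U where U: "U \<in> \<S>" "A \<circ> U \<circ> (S \<circ> A) \<noteq> (\<lambda>x. 0)"
    using ex_linking[OF A_mem comp_mem[OF S(1) A_mem] A_nz S(2)] .
  have "A \<circ> U \<noteq> (\<lambda>x. 0)" using U(2) by (auto simp: fun_eq_iff)
  then show "M \<in> {range ((A \<circ> U)\<^sup>\<dagger>) | U. U \<in> \<S> \<and> A \<circ> U \<noteq> (\<lambda>x. 0)}"
    using range_eq_range_adjoint[OF S(1) U] S(3) U(1) by blast
next
  fix M assume "M \<in> {range ((A \<circ> U)\<^sup>\<dagger>) | U. U \<in> \<S> \<and> A \<circ> U \<noteq> (\<lambda>x. 0)}"
  then obtain U where U: "U \<in> \<S>" "A \<circ> U \<noteq> (\<lambda>x. 0)" "M = range ((A \<circ> U)\<^sup>\<dagger>)"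
    by blast
  obtain S where S: "S \<in> \<S>" "A \<circ> U \<circ> S \<circ> A \<noteq> (\<lambda>x. 0)"
    using ex_linking[OF comp_mem[OF A_mem U(1)] A_mem U(2) A_nz] .
  have nz: "A \<circ> U \<circ> (S \<circ> A) \<noteq> (\<lambda>x. 0)" using S(2) by (simp add: comp_assoc)
  have zero: "A (U 0) = 0" by (simp add: bounded_operator_zero bdd A_mem U)
  have "S \<circ> A \<noteq> (\<lambda>x. 0)" by (rule notI) (use nz zero in \<open>simp add: fun_eq_iff\<close>)
  then show "M \<in> blocks"
    using range_eq_range_adjoint[OF S(1) U(1) nz] U(3) S(1) unfolding blocks_def by blast
qed

text \<open>Modelled on monomial matrices: at most one nonzero entry in each block column, and that
  entry isometric. The image must be a full block, which keeps the condition stable under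
  composition.\<close>

definition block_monomial :: "('a \<Rightarrow> 'a) \<Rightarrow> bool" where
  "block_monomial W \<longleftrightarrow> (\<forall>M\<in>blocks. (\<forall>x\<in>M. W x = 0) \<or>
     (\<forall>x\<in>M. norm (W x) = norm x) \<and> W ` M \<in> blocks)"

lemma block_monomial_comp:
  assumes V: "block_monomial V" and W: "block_monomial W" and zero: "V 0 = 0"
  shows "block_monomial (V \<circ> W)"
  unfolding block_monomial_def
proof
  fix M assume M: "M \<in> blocks"
  consider "\<forall>x\<in>M. W x = 0" | "\<forall>x\<in>M. norm (W x) = norm x" "W ` M \<in> blocks"
    using W M unfolding block_monomial_def by blast
  then show "(\<forall>x\<in>M. (V \<circ> W) x = 0) \<or>
     (\<forall>x\<in>M. norm ((V \<circ> W) x) = norm x) \<and> (V \<circ> W) ` M \<in> blocks"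
  proof cases
    case 1
    then show ?thesis using zero by simp
  next
    case 2
    then consider "\<forall>y\<in>W ` M. V y = 0"
      | "\<forall>y\<in>W ` M. norm (V y) = norm y" "V ` W ` M \<in> blocks"
      using V unfolding block_monomial_def by blast
    then show ?thesis by cases (use 2(1) in \<open>simp_all add: image_comp\<close>)
  qed
qed

text \<open>If \<open>S \<circ> T \<circ> A\<close> is nonzero, it has the same initial projection
  as \<open>T \<circ> A\<close>, so \<open>S\<close> preserves norms on the range of
  \<open>T \<circ> A\<close>.\<close>

lemma block_monomial_mem:
  assumes S: "S \<in> \<S>"
  shows "block_monomial S"
  unfolding block_monomial_def
proof
  fix M assume "M \<in> blocks"
  then obtain T where T: "T \<in> \<S>" "T \<circ> A \<noteq> (\<lambda>x. 0)" "M = range (T \<circ> A)"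
    by (auto simp: blocks_def)
  show "(\<forall>x\<in>M. S x = 0) \<or> (\<forall>x\<in>M. norm (S x) = norm x) \<and> S ` M \<in> blocks"
  proof (cases "S \<circ> T \<circ> A = (\<lambda>x. 0)")
    case True
    then show ?thesis by (auto simp: T(3) fun_eq_iff)
  next
    case False
    have "initial_projection (S \<circ> T \<circ> A) = initial_projection (T \<circ> A)"
      using minimal_initial[OF min A_mem _ A_init] False T S comp_mem by simp
    then have "norm ((S \<circ> T \<circ> A) x) = norm ((T \<circ> A) x)" for x
      by (rule norm_eq_of_initial_projection_eq[rotated 2]) (simp_all add: bdd comp_mem S T A_mem)
    moreover have "range (S \<circ> T \<circ> A) \<in> blocks"
      using False comp_mem[OF S T(1)] unfolding blocks_def by blast
    moreover have "S ` M = range (S \<circ> T \<circ> A)" by (auto simp: T(3) image_comp comp_assoc)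
    ultimately show ?thesis by (auto simp: T(3))
  qed
qed

text \<open>In the adjoint description of blocks, \<open>S\<^sup>\<dagger>\<close> sends the range
  of \<open>(A \<circ> U)\<^sup>\<dagger>\<close> to that of
  \<open>(A \<circ> U \<circ> S)\<^sup>\<dagger>\<close>. Unless the latter operator vanishes, both
  have initial projection \<open>R\<close>.\<close>

lemma block_monomial_adjoint_mem:
  assumes S: "S \<in> \<S>"
  shows "block_monomial (S\<^sup>\<dagger>)"
  unfolding block_monomial_def
proof
  fix M assume "M \<in> blocks"
  then obtain U where U: "U \<in> \<S>" "A \<circ> U \<noteq> (\<lambda>x. 0)" "M = range ((A \<circ> U)\<^sup>\<dagger>)"
    by (auto simp: blocks_adjoint)
  have mem: "A \<circ> U \<in> \<S>" "A \<circ> U \<circ> S \<in> \<S>" by (simp_all add: comp_mem A_mem U S)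
  have eq: "(A \<circ> U \<circ> S)\<^sup>\<dagger> = S\<^sup>\<dagger> \<circ> (A \<circ> U)\<^sup>\<dagger>" by (simp only: adjoint_comp bdd S mem)
  have img: "(S\<^sup>\<dagger>) ` M = range ((A \<circ> U \<circ> S)\<^sup>\<dagger>)" by (simp only: U(3) eq image_comp)
  show "(\<forall>x\<in>M. (S\<^sup>\<dagger>) x = 0) \<or> (\<forall>x\<in>M. norm ((S\<^sup>\<dagger>) x) = norm x) \<and> (S\<^sup>\<dagger>) ` M \<in> blocks"
  proof (cases "A \<circ> U \<circ> S = (\<lambda>x. 0)")
    case True
    have "(A \<circ> U \<circ> S)\<^sup>\<dagger> = (\<lambda>x. 0)"
      using mem(2) unfolding True by (intro adjoint_eqI) (auto dest: bdd)
    then have "(S\<^sup>\<dagger>) x = 0" if "x \<in> M" for x using img that by auto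
    then show ?thesis by blast
  next
    case False
    have "range_projection (A \<circ> (U \<circ> S)) = range_projection (A \<circ> U)"
      using minimal_range[OF min A_mem _ A_range] False U S comp_mem by (simp add: comp_assoc)
    then have "initial_projection ((A \<circ> U \<circ> S)\<^sup>\<dagger>) = initial_projection ((A \<circ> U)\<^sup>\<dagger>)"
      by (simp add: initial_projection_adjoint adjoint_adjoint bounded_operator_adjoint bdd mem
          comp_assoc[symmetric])
    then have "norm (((A \<circ> U \<circ> S)\<^sup>\<dagger>) x) = norm (((A \<circ> U)\<^sup>\<dagger>) x)" for x
      by (rule norm_eq_of_initial_projection_eq[rotated 2])
        (simp_all add: bounded_operator_adjoint bdd mem)
    then have "\<forall>x\<in>M. norm ((S\<^sup>\<dagger>) x) = norm x" by (auto simp: U(3) eq)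
    moreover have "(S\<^sup>\<dagger>) ` M \<in> blocks"
      unfolding img blocks_adjoint using False comp_mem[OF U(1) S] by (auto simp: comp_assoc)
    ultimately show ?thesis by blast
  qed
qed

lemma generated_block_monomial:
  assumes "W \<in> generated_semigroup (\<S> \<union> hilbert_adjoint ` \<S>)"
  shows "bounded_operator W \<and> block_monomial W \<and> block_monomial (W\<^sup>\<dagger>)"
  using assms
proof induction
  case (base W)
  then show ?case
    by (auto simp: bdd bounded_operator_adjoint adjoint_adjoint
        block_monomial_mem block_monomial_adjoint_mem)
next
  case (comp V W)
  then have V: "bounded_operator V" "block_monomial V" "block_monomial (V\<^sup>\<dagger>)"
    and W: "bounded_operator W" "block_monomial W" "block_monomial (W\<^sup>\<dagger>)"
    by auto
  have "block_monomial (W\<^sup>\<dagger> \<circ> V\<^sup>\<dagger>)"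
    by (rule block_monomial_comp[OF W(3) V(3)])
      (rule bounded_operator_zero[OF bounded_operator_adjoint[OF W(1)]])
  then show ?case
    using bounded_operator_comp[OF V(1) W(1)] adjoint_comp[OF V(1) W(1)]
      block_monomial_comp[OF V(2) W(2) bounded_operator_zero[OF V(1)]] by (simp only:)
qed

text \<open>
  Why \<open>WW\<^sup>*\<close> is zero or the identity on a block: if \<open>W\<^sup>*\<close> is isometric on a block, then
  \<open>\<langle>WW\<^sup>* x, x\<rangle> = \<parallel>x\<parallel>\<^sup>2\<close> there, while \<open>\<parallel>WW\<^sup>* x\<parallel>\<close> is \<open>0\<close> or \<open>\<parallel>x\<parallel>\<close>.
\<close>

lemma block_monomial_partial_isometry:
  assumes W: "bounded_operator W" and mono: "block_monomial W" "block_monomial (W\<^sup>\<dagger>)"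
  shows "partial_isometry W"
proof -
  define Q where "Q = W \<circ> W\<^sup>\<dagger>"
  have W': "bounded_operator (W\<^sup>\<dagger>)" by (rule bounded_operator_adjoint[OF W])
  have Q: "bounded_operator Q" unfolding Q_def by (rule bounded_operator_comp[OF W W'])
  have on_block: "Q x = 0 \<or> Q x = x" if M: "M \<in> blocks" and x: "x \<in> M" for M x
  proof -
    consider "(W\<^sup>\<dagger>) x = 0" | "norm ((W\<^sup>\<dagger>) x) = norm x" "(W\<^sup>\<dagger>) ` M \<in> blocks"
      using mono(2) M x unfolding block_monomial_def by blast
    then show ?thesis
    proof cases
      case 1
      then show ?thesis by (simp add: Q_def bounded_operator_zero W)
    next
      case 2
      \<comment> \<open>The image of \<open>M\<close> under \<open>W\<^sup>\<dagger>\<close> is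
        itself a block, so the alternative for \<open>W\<close> applies there.\<close>
      then consider "Q x = 0" | "norm (Q x) = norm x"
        using mono(1) x unfolding block_monomial_def Q_def by fastforce
      then show ?thesis
      proof cases
        case 2
        have "Re (cinner (Q x) x) = (norm x)\<^sup>2"
          using \<open>norm ((W\<^sup>\<dagger>) x) = norm x\<close> norm_sq_cinner[of "(W\<^sup>\<dagger>) x"]
          by (simp add: Q_def cinner_adjoint_right W)
        then have "(norm (Q x - x))\<^sup>2 = 0" by (simp add: norm_sq_diff 2)
        then show ?thesis by simp
      qed simp
    qed
  qed
  \<comment> \<open>\<open>D\<close> is the defect of idempotence of \<open>Q\<close>. It vanishes
    on blocks, hence on the orbit of a nonzero vector \<open>A a\<close>, and
    \<open>orbit_annihilator\<close> makes it zero.\<close>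
  define D where "D = (\<lambda>x. Q (Q x - x))"
  have "bounded_linear (\<lambda>x. Q x - x)"
    by (intro bounded_linear_sub bounded_operator_linear[OF Q] bounded_linear_ident)
  then have "bounded_operator (\<lambda>x. Q x - x)"
    by (simp add: bounded_operator_def bounded_operator_scaleC[OF Q]
        complex_vector.scale_right_diff_distrib)
  then have D: "bounded_operator D"
    using bounded_operator_comp[OF Q] by (simp add: D_def comp_def)
  obtain a where a: "A a \<noteq> 0" using A_nz by auto
  have "D (T (A a)) = 0" if T: "T \<in> \<S>" for T
  proof (cases "T \<circ> A = (\<lambda>x. 0)")
    case True
    then have "T (A a) = 0" by (simp add: fun_eq_iff)
    then show ?thesis by (simp add: bounded_operator_zero D)
  next
    case False
    then have "range (T \<circ> A) \<in> blocks" using T unfolding blocks_def by blast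
    then have "Q (T (A a)) = 0 \<or> Q (T (A a)) = T (A a)" by (rule on_block) auto
    then show ?thesis
      by (auto simp: D_def bounded_operator_zero bounded_operator_diff Q)
  qed
  then have "D = (\<lambda>x. 0)" by (rule orbit_annihilator[OF D a])
  then have "Q \<circ> Q = Q" by (simp add: D_def fun_eq_iff bounded_operator_diff Q)
  moreover have "Q\<^sup>\<dagger> = Q" by (simp add: Q_def adjoint_comp adjoint_adjoint W W')
  ultimately show ?thesis
    using W Q by (simp add: partial_isometry_def orthogonal_projection_def range_projection_def Q_def)
qed

end

theorem theorem2p11:
  fixes \<S> :: "('a::complex_hilbert_space \<Rightarrow> 'a) set" and R :: "'a \<Rightarrow> 'a"
  assumes infinite_dimensional: "\<not> (\<exists>B :: 'a set. finite B \<and> cspan B = UNIV)"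
    and separable: "\<exists>D :: 'a set. countable D \<and> closure D = UNIV"
    and semigroup: "unital_semigroup \<S>"
    and partial_isometries: "\<forall>V\<in>\<S>. partial_isometry V"
    and irreducible: "irreducible_operators \<S>"
    and minimal: "minimal_projection_in (initial_projection ` \<S> \<union> range_projection ` \<S>) R"
  shows "\<forall>V\<in>generated_semigroup (\<S> \<union> hilbert_adjoint ` \<S>). partial_isometry V"
proof -
  interpret irreducible_partial_isometries \<S>
    using semigroup partial_isometries irreducible by unfold_locales auto
  obtain A where A: "A \<in> \<S>" "initial_projection A = R" "range_projection A = R" "A \<noteq> (\<lambda>x. 0)"
    using ex_partial_unitary[OF minimal] .
  interpret partial_unitary_in \<S> R A
    using A minimal by unfold_locales
  show ?thesis
    using generated_block_monomial block_monomial_partial_isometry by blast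
qed

end
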